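(* Let $X,Y$ be topological spaces, let $f$ be a bounded measurable function on $X\times Y$ separating measures on $X$, and let $(T_t)_{t\ge 0}$ be a semigroup of integral operators in $B(X)$ specified by a family of bounded signed kernels $p_t(x,dz)$ from $X$ to $X$, so that $T_0$ is the identity operator and $T_tT_s=T_{t+s}$ (in terms of kernels, $\int_X p_t(x,dz)\,p_s(z,dw)=p_{t+s}(x,dw)$). Then the $f$-dual operators $T_t^{D(f)}$ in $F(\mathcal{M}(X))$ also form a semigroup, and $$T_t^{D(f)}=F\circ T_t'\circ F^{-1}.$$
   Context: For a topological space $X$, $B(X)$ is the Banach space of bounded Borel measurable functions with the sup-norm, and $\mathcal{M}(X)$ is the Banach space of bounded signed ($\sigma$-additive) Borel measures with the total variation norm. A signed kernel from $X$ to $X$ is a function $p(x,A)$ of $x\in X$ and Borel $A\subset X$ such that $p(x,\cdot)$ is a bounded signed measure for each $x$ and $p(\cdot,A)$ is Borel for each $A$; it is bounded if $\sup_x\|p(x,\cdot)\|<\infty$. The integral operator with kernel $p$ is $Tg(x)=\int_X g(z)\,p(x,dz)$; its standard dual $T':\mathcal{M}(X)\to\mathcal{M}(X)$ is $T'\mu(dz)=\int_X p(x,dz)\,\mu(dx)$. The function $f$ separates measures on $X$ if for any distinct $Q_1,Q_2\in\mathcal{M}(X)$ there is $y\in Y$ with $\int f(x,y)Q_1(dx)\ne\int f(x,y)Q_2(dx)$. The operator $F:\mathcal{M}(X)\to B(Y)$ is $(FQ)(y)=\int_X f(x,y)\,Q(dx)$; when $f$ separates measures, $F$ is injective and $F^{-1}$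 is defined on the image $F(\mathcal{M}(X))$. An operator $T^{D(f)}$ on functions on $Y$ is $f$-dual to $T$ if $(T^{D(f)}f(x,\cdot))(y)=(Tf(\cdot,y))(x)$ for all $x\in X$, $y\in Y$. On a function $g=FQ$, i.e. $g(y)=\int f(x,y)Q(dx)$, the $f$-dual operator is understood to act by linearity under the integral: $T^{D(f)}g(y)=\int_X (T^{D(f)}f(x,\cdot))(y)\,Q(dx)$. *)

theory Defs
  imports "HOL-Analysis.Analysis"
begin

definition bounded_borel :: "('a::topological_space \<Rightarrow> real) set" where
  "bounded_borel = {g \<in> borel_measurable borel. bounded (range g)}"

text \<open>Signed measures are real-valued set functions. As for \<^const>\<open>emeasure\<close> and
  \<^const>\<open>measure\<close>, the value on non-Borel sets is fixed to be 0, so that equality of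
  functions is equality of signed measures.\<close>

definition total_variation :: "('a::topological_space set \<Rightarrow> real) \<Rightarrow> ennreal" where
  "total_variation \<mu> =
     (SUP \<P> \<in> {\<P>. finite \<P> \<and> \<P> \<subseteq> sets borel \<and> disjoint \<P>}. \<Sum>A\<in>\<P>. ennreal \<bar>\<mu> A\<bar>)"

definition signed_measures :: "('a::topological_space set \<Rightarrow> real) set" where
  "signed_measures = {\<mu>.
     (\<forall>A. A \<notin> sets borel \<longrightarrow> \<mu> A = 0) \<and>
     \<mu> {} = 0 \<and>
     (\<forall>A :: nat \<Rightarrow> 'a set. range A \<subseteq> sets borel \<longrightarrow> disjoint_family A \<longrightarrow>
        (\<lambda>n. \<mu> (A n)) sums \<mu> (\<Union>n. A n)) \<and>
     total_variation \<mu> < \<infinity>}"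

text \<open>The positive part of the Jordan decomposition is the upper variation
  \<open>\<mu>\<^sup>+ A = sup {\<mu> B | B \<subseteq> A}\<close>. Since \<^const>\<open>ennreal\<close> truncates negative numbers to 0 and
  \<open>B = {}\<close> contributes 0, the truncation does not affect the supremum. The negative part is
  the positive part of \<open>-\<mu>\<close>.\<close>

definition positive_part :: "('a::topological_space set \<Rightarrow> real) \<Rightarrow> 'a measure" where
  "positive_part \<mu> =
     measure_of UNIV (sets borel) (\<lambda>A. SUP B \<in> {B \<in> sets borel. B \<subseteq> A}. ennreal (\<mu> B))"

definition negative_part :: "('a::topological_space set \<Rightarrow> real) \<Rightarrow> 'a measure" where
  "negative_part \<mu> = positive_part (\<lambda>A. - \<mu> A)"

definition signed_integral ::
    "('a::topological_space set \<Rightarrow> real) \<Rightarrow> ('a \<Rightarrow> real) \<Rightarrow> real" where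
  "signed_integral \<mu> g =
     integral\<^sup>L (positive_part \<mu>) g - integral\<^sup>L (negative_part \<mu>) g"

definition signed_kernel :: "('a::topological_space \<Rightarrow> 'a set \<Rightarrow> real) \<Rightarrow> bool" where
  "signed_kernel p \<longleftrightarrow>
     (\<forall>x. p x \<in> signed_measures) \<and>
     (\<forall>A \<in> sets borel. (\<lambda>x. p x A) \<in> borel_measurable borel)"

definition bounded_signed_kernel :: "('a::topological_space \<Rightarrow> 'a set \<Rightarrow> real) \<Rightarrow> bool" where
  "bounded_signed_kernel p \<longleftrightarrow>
     signed_kernel p \<and> (SUP x. total_variation (p x)) < \<infinity>"

definition integral_operator ::
    "('a::topological_space \<Rightarrow> 'a set \<Rightarrow> real) \<Rightarrow> ('a \<Rightarrow> real) \<Rightarrow> 'a \<Rightarrow> real" where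
  "integral_operator p g = (\<lambda>x. signed_integral (p x) g)"

definition dual_operator ::
    "('a::topological_space \<Rightarrow> 'a set \<Rightarrow> real) \<Rightarrow> ('a set \<Rightarrow> real) \<Rightarrow> 'a set \<Rightarrow> real" where
  "dual_operator p \<mu> =
     (\<lambda>A. if A \<in> sets borel then signed_integral \<mu> (\<lambda>x. p x A) else 0)"

text \<open>The transform is a function on the second space. It is Borel for every \<open>Q\<close> when \<open>f\<close> is
  measurable for the product of the two Borel sigma-algebras; for \<open>f\<close> that is only Borel on
  the product topology, a weaker condition in general, measurability can fail.\<close>

definition integral_transform ::
    "('a::topological_space \<times> 'b \<Rightarrow> real) \<Rightarrow> ('a set \<Rightarrow> real) \<Rightarrow> 'b \<Rightarrow> real" where
  "integral_transform f Q = (\<lambda>y. signed_integral Q (\<lambda>x. f (x, y)))"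

definition separates_measures :: "('a::topological_space \<times> 'b \<Rightarrow> real) \<Rightarrow> bool" where
  "separates_measures f \<longleftrightarrow>
     (\<forall>Q\<^sub>1 \<in> signed_measures. \<forall>Q\<^sub>2 \<in> signed_measures. Q\<^sub>1 \<noteq> Q\<^sub>2 \<longrightarrow>
        (\<exists>y. signed_integral Q\<^sub>1 (\<lambda>x. f (x, y)) \<noteq> signed_integral Q\<^sub>2 (\<lambda>x. f (x, y))))"

text \<open>The second clause is the convention that an \<open>f\<close>-dual operator acts on
  \<open>g = \<integral> f(x, \<cdot>) Q(dx)\<close> under the integral sign. The values of \<open>TD\<close> on functions that are
  not of this form are left unconstrained.\<close>

definition f_dual ::
    "('a::topological_space \<times> 'b \<Rightarrow> real) \<Rightarrow> (('a \<Rightarrow> real) \<Rightarrow> 'a \<Rightarrow> real) \<Rightarrow>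
     (('b \<Rightarrow> real) \<Rightarrow> 'b \<Rightarrow> real) \<Rightarrow> bool" where
  "f_dual f T TD \<longleftrightarrow>
     (\<forall>x y. TD (\<lambda>y'. f (x, y')) y = T (\<lambda>x'. f (x', y)) x) \<and>
     (\<forall>Q \<in> signed_measures. \<forall>y.
        TD (integral_transform f Q) y = signed_integral Q (\<lambda>x. TD (\<lambda>y'. f (x, y')) y))"

text \<open>A one-parameter semigroup of linear operators in a linear space \<open>V\<close> of functions;
  no continuity in the parameter is required.\<close>

definition operator_semigroup ::
    "('c \<Rightarrow> real) set \<Rightarrow> (real \<Rightarrow> ('c \<Rightarrow> real) \<Rightarrow> 'c \<Rightarrow> real) \<Rightarrow> bool" where
  "operator_semigroup V T \<longleftrightarrow>
     (\<forall>t\<ge>0. \<forall>g\<in>V. T t g \<in> V) \<and>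
     (\<forall>t\<ge>0. \<forall>g\<in>V. \<forall>h\<in>V. \<forall>a b.
        T t (\<lambda>z. a * g z + b * h z) = (\<lambda>z. a * T t g z + b * T t h z)) \<and>
     (\<forall>g\<in>V. T 0 g = g) \<and>
     (\<forall>s\<ge>0. \<forall>t\<ge>0. \<forall>g\<in>V. T t (T s g) = T (t + s) g)"

end

theory Submission
  imports Defs
begin

text \<open>The heart of the matter is the duality \<open>\<integral> g d(T'Q) = \<integral> (T g) dQ\<close> for bounded Borel \<open>g\<close>.
  It holds for indicators by the definition of \<open>T'\<close>, and passes to all bounded Borel
  functions by linearity and bounded convergence. With \<open>g = f(\<cdot>, y)\<close> it says that
  any \<open>f\<close>-dual operator maps \<open>F Q\<close> to \<open>F (T' Q)\<close>, and the semigroup law for \<open>T\<close>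
  is carried over. Conversely, \<open>F \<circ> T' \<circ> F\<^sup>-\<^sup>1\<close> is \<open>f\<close>-dual to \<open>T\<close>,
  because \<open>f(x, \<cdot>)\<close> is the transform of the Dirac measure at \<open>x\<close>.\<close>

section \<open>Signed measures\<close>

lemma total_variation_leI:
  fixes \<mu> :: "'a::topological_space set \<Rightarrow> real"
  assumes "\<And>\<P>. finite \<P> \<Longrightarrow> \<P> \<subseteq> sets borel \<Longrightarrow> disjoint \<P> \<Longrightarrow> (\<Sum>A\<in>\<P>. \<bar>\<mu> A\<bar>) \<le> C"
  shows "total_variation \<mu> \<le> ennreal C"
  unfolding total_variation_def
  by (rule SUP_least) (auto simp: sum_ennreal intro!: ennreal_leI assms)

lemma sum_abs_le_total_variation:
  fixes \<mu> :: "'a::topological_space set \<Rightarrow> real"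
  assumes "finite \<P>" "\<P> \<subseteq> sets borel" "disjoint \<P>"
    and "total_variation \<mu> \<le> ennreal C" "0 \<le> C"
  shows "(\<Sum>A\<in>\<P>. \<bar>\<mu> A\<bar>) \<le> C"
proof -
  have "(\<Sum>A\<in>\<P>. ennreal \<bar>\<mu> A\<bar>) \<le> total_variation \<mu>"
    unfolding total_variation_def by (rule SUP_upper) (use assms in auto)
  also have "\<dots> \<le> ennreal C" by fact
  finally show ?thesis using assms(5) by (simp add: sum_ennreal)
qed

lemma abs_le_total_variation:
  assumes "A \<in> sets borel" "total_variation \<mu> \<le> ennreal C" "0 \<le> C"
  shows "\<bar>\<mu> A\<bar> \<le> C"
  using sum_abs_le_total_variation[of "{A}" \<mu> C] assms by (simp add: disjoint_def)

lemma signed_measures_total_variation: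
  assumes "\<mu> \<in> signed_measures"
  obtains C where "0 \<le> C" "total_variation \<mu> \<le> ennreal C"
proof
  show "total_variation \<mu> \<le> ennreal (enn2real (total_variation \<mu>))"
    using assms by (simp add: signed_measures_def)
qed simp

text \<open>Finiteness of the total variation is reduced to one real bound \<open>C\<close> valid
  for all finite disjoint Borel families, so that the estimates for sums, kernels and Dirac measures
  can be made in the reals instead of \<open>ennreal\<close>.\<close>

lemma signed_measuresI:
  fixes \<mu> :: "'a::topological_space set \<Rightarrow> real"
  assumes "\<And>A. A \<notin> sets borel \<Longrightarrow> \<mu> A = 0" "\<mu> {} = 0"
    and "\<And>A :: nat \<Rightarrow> 'a set. range A \<subseteq> sets borel \<Longrightarrow> disjoint_family A \<Longrightarrow>
      (\<lambda>n. \<mu> (A n)) sums \<mu> (\<Union>n. A n)"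
    and "\<And>\<P>. finite \<P> \<Longrightarrow> \<P> \<subseteq> sets borel \<Longrightarrow> disjoint \<P> \<Longrightarrow> (\<Sum>A\<in>\<P>. \<bar>\<mu> A\<bar>) \<le> C"
  shows "\<mu> \<in> signed_measures"
proof -
  have "total_variation \<mu> < \<infinity>"
    using total_variation_leI[of \<mu> C] assms(4) by (simp add: order_le_less_trans)
  then show ?thesis using assms(1-3) by (simp add: signed_measures_def)
qed

lemma signed_measures_sums:
  assumes "\<mu> \<in> signed_measures" "range A \<subseteq> sets borel" "disjoint_family A"
  shows "(\<lambda>n. \<mu> (A n)) sums \<mu> (\<Union>n. A n)"
  using assms by (simp add: signed_measures_def)

lemma signed_measures_empty: "\<mu> \<in> signed_measures \<Longrightarrow> \<mu> {} = 0"
  by (simp add: signed_measures_def)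

lemma signed_measures_Un:
  assumes "\<mu> \<in> signed_measures" "A \<in> sets borel" "B \<in> sets borel" "A \<inter> B = {}"
  shows "\<mu> (A \<union> B) = \<mu> A + \<mu> B"
proof -
  \<comment> \<open>The sequence \<open>A, B, {}, {}, ...\<close> turns countable into finite
    additivity; its tail contributes nothing because \<open>\<mu> {} = 0\<close>.\<close>
  have "disjoint_family (binaryset A B)"
    using assms(4) by (auto simp: disjoint_family_on_def binaryset_def)
  then have "(\<lambda>n. \<mu> (binaryset A B n)) sums \<mu> (A \<union> B)"
    using signed_measures_sums[of \<mu> "binaryset A B"] assms
    by (simp add: range_binaryset_eq UN_binaryset_eq)
  moreover have "(\<lambda>n. \<mu> (binaryset A B n)) sums (\<mu> A + \<mu> B)"
    by (rule binaryset_sums) (rule signed_measures_empty[OF assms(1)])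
  ultimately show ?thesis by (rule sums_unique2)
qed

text \<open>Used for domination: a partial sum of the series for a countable union is the value of
  \<open>\<mu>\<close> at a single set, hence bounded by the total variation uniformly in
  \<open>n\<close>.\<close>

lemma signed_measures_sum_disjoint:
  assumes "\<mu> \<in> signed_measures" "range A \<subseteq> sets borel" "disjoint_family A"
  shows "(\<Sum>i<n. \<mu> (A i)) = \<mu> (\<Union>i<n::nat. A i)"
proof (induction n)
  case 0
  then show ?case by (simp add: signed_measures_empty[OF assms(1)])
next
  case (Suc n)
  have "A i \<inter> A n = {}" if "i < n" for i
    using disjoint_family_onD[OF assms(3), of i n] that by simp
  then have "A n \<inter> (\<Union>i<n. A i) = {}" by blast
  then have "\<mu> (A n \<union> (\<Union>i<n. A i)) = \<mu> (A n) + \<mu> (\<Union>i<n. A i)"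
    using assms(2) by (intro signed_measures_Un assms(1)) auto
  then show ?case using Suc by (simp add: lessThan_Suc)
qed

lemma signed_measures_lincomb:
  fixes \<mu> \<nu> :: "'a::topological_space set \<Rightarrow> real"
  assumes "\<mu> \<in> signed_measures" "\<nu> \<in> signed_measures"
  shows "(\<lambda>A. a * \<mu> A + b * \<nu> A) \<in> signed_measures"
proof -
  obtain C where C: "0 \<le> C" "total_variation \<mu> \<le> ennreal C"
    using assms(1) by (rule signed_measures_total_variation)
  obtain D where D: "0 \<le> D" "total_variation \<nu> \<le> ennreal D"
    using assms(2) by (rule signed_measures_total_variation)
  show ?thesis
  proof (rule signed_measuresI[where C = "\<bar>a\<bar> * C + \<bar>b\<bar> * D"])
    fix \<P> :: "'a set set" assume P: "finite \<P>" "\<P> \<subseteq> sets borel" "disjoint \<P>"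
    have "(\<Sum>A\<in>\<P>. \<bar>a * \<mu> A + b * \<nu> A\<bar>) \<le> (\<Sum>A\<in>\<P>. \<bar>a\<bar> * \<bar>\<mu> A\<bar> + \<bar>b\<bar> * \<bar>\<nu> A\<bar>)"
      by (intro sum_mono) (simp add: abs_mult[symmetric] abs_triangle_ineq)
    also have "\<dots> = \<bar>a\<bar> * (\<Sum>A\<in>\<P>. \<bar>\<mu> A\<bar>) + \<bar>b\<bar> * (\<Sum>A\<in>\<P>. \<bar>\<nu> A\<bar>)"
      by (simp add: sum.distrib sum_distrib_left)
    also have "\<dots> \<le> \<bar>a\<bar> * C + \<bar>b\<bar> * D"
      by (intro add_mono mult_left_mono sum_abs_le_total_variation P C D) auto
    finally show "(\<Sum>A\<in>\<P>. \<bar>a * \<mu> A + b * \<nu> A\<bar>) \<le> \<bar>a\<bar> * C + \<bar>b\<bar> * D" .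
  qed (use assms in \<open>auto simp: signed_measures_def intro!: sums_add sums_mult\<close>)
qed

lemma signed_measures_uminus: "\<mu> \<in> signed_measures \<Longrightarrow> (\<lambda>A. - \<mu> A) \<in> signed_measures"
  using signed_measures_lincomb[of \<mu> \<mu> "-1" 0] by simp

section \<open>The Jordan decomposition\<close>

lemma space_positive_part [simp]: "space (positive_part \<mu>) = UNIV"
  and sets_positive_part [measurable_cong, simp]: "sets (positive_part \<mu>) = sets borel"
proof -
  have "sigma_sets UNIV (sets borel) = (sets borel :: 'a set set)"
    using sets.sigma_sets_eq[of borel] by simp
  then show "space (positive_part \<mu>) = UNIV" "sets (positive_part \<mu>) = sets borel"
    unfolding positive_part_def by (simp_all add: space_measure_of_conv)
qed

lemma space_negative_part [simp]: "space (negative_part \<mu>) = UNIV"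
  and sets_negative_part [measurable_cong, simp]: "sets (negative_part \<mu>) = sets borel"
  by (simp_all add: negative_part_def)

text \<open>\<open>measure_of\<close> returns the intended values only for a genuine measure, so the
  content is that the upper variation \<open>q\<close> is countably additive. Superadditivity on
  disjoint sets together with monotonicity gives one inequality, cutting a competitor along the
  partition gives the other.\<close>

lemma emeasure_positive_part:
  fixes \<mu> :: "'a::topological_space set \<Rightarrow> real"
  assumes \<mu>: "\<mu> \<in> signed_measures" and "A \<in> sets borel"
  shows "emeasure (positive_part \<mu>) A = (SUP B \<in> {B \<in> sets borel. B \<subseteq> A}. ennreal (\<mu> B))"
proof -
  define q where "q A = (SUP B \<in> {B \<in> sets borel. B \<subseteq> A}. ennreal (\<mu> B))" for A
  have q_upper: "ennreal (\<mu> B) \<le> q A" if "B \<in> sets borel" "B \<subseteq> A" for A B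
    unfolding q_def by (rule SUP_upper) (use that in auto)
  have mono: "q A \<le> q B" if "A \<subseteq> B" for A B
    unfolding q_def by (rule SUP_subset_mono) (use that in auto)
  have q_empty: "q {} = 0"
    unfolding q_def using signed_measures_empty[OF \<mu>] by (simp add: le_zero_eq[symmetric] SUP_le_iff)
  have q_Un: "q A + q B \<le> q (A \<union> B)" if AB: "A \<inter> B = {}" for A B
  proof -
    \<comment> \<open>If both values are nonnegative, \<open>C \<union> D\<close> is a competitor
      for \<open>A \<union> B\<close> realising the sum. Otherwise \<open>ennreal\<close> truncates
      a negative value to 0, and the remaining set alone is a competitor.\<close>
    have *: "ennreal (\<mu> C) + ennreal (\<mu> D) \<le> q (A \<union> B)"
      if "C \<in> sets borel" "C \<subseteq> A" "D \<in> sets borel" "D \<subseteq> B" for C D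
    proof (cases "\<mu> C \<ge> 0 \<and> \<mu> D \<ge> 0")
      case True
      have "\<mu> (C \<union> D) = \<mu> C + \<mu> D"
        by (rule signed_measures_Un) (use \<mu> that AB in auto)
      then have "ennreal (\<mu> C) + ennreal (\<mu> D) = ennreal (\<mu> (C \<union> D))"
        using True by simp
      also have "\<dots> \<le> q (A \<union> B)" by (rule q_upper) (use that in auto)
      finally show ?thesis .
    next
      case False
      then have "ennreal (\<mu> C) + ennreal (\<mu> D) \<le> max (ennreal (\<mu> C)) (ennreal (\<mu> D))"
        by (auto simp: ennreal_neg)
      also have "\<dots> \<le> q (A \<union> B)"
        by (intro max.boundedI q_upper) (use that in auto)
      finally show ?thesis .
    qed
    have "q A + q B = (SUP C \<in> {C \<in> sets borel. C \<subseteq> A}. ennreal (\<mu> C) + q B)"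
      unfolding q_def[of A] by (rule ennreal_SUP_add_left[symmetric]) auto
    also have "\<dots> \<le> q (A \<union> B)"
    proof (rule SUP_least)
      fix C assume C: "C \<in> {C \<in> sets borel. C \<subseteq> A}"
      have "ennreal (\<mu> C) + q B = (SUP D \<in> {D \<in> sets borel. D \<subseteq> B}. ennreal (\<mu> C) + ennreal (\<mu> D))"
        unfolding q_def[of B] by (rule ennreal_SUP_add_right) auto
      also have "\<dots> \<le> q (A \<union> B)"
        by (rule SUP_least) (use C * in auto)
      finally show "ennreal (\<mu> C) + q B \<le> q (A \<union> B)" .
    qed
    finally show ?thesis .
  qed
  have "countably_additive (sets borel) q"
  proof (rule countably_additiveI)
    fix A :: "nat \<Rightarrow> 'a set"
    assume A: "range A \<subseteq> sets borel" "disjoint_family A"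
    have "(\<Sum>i<n. q (A i)) \<le> q (\<Union>i<n. A i)" for n
    proof (induction n)
      case (Suc n)
      have "A i \<inter> A n = {}" if "i < n" for i
        using disjoint_family_onD[OF A(2), of i n] that by simp
      then have disj: "(\<Union>i<n. A i) \<inter> A n = {}" by blast
      have "(\<Sum>i<Suc n. q (A i)) \<le> q (\<Union>i<n. A i) + q (A n)"
        using Suc by (simp add: add_right_mono)
      also have "\<dots> \<le> q ((\<Union>i<n. A i) \<union> A n)" by (rule q_Un[OF disj])
      also have "(\<Union>i<n. A i) \<union> A n = (\<Union>i<Suc n. A i)" by (auto simp: lessThan_Suc)
      finally show ?case .
    qed (simp add: q_empty)
    then have "(\<Sum>i<n. q (A i)) \<le> q (\<Union>i. A i)" for n
      by (rule order_trans) (auto intro!: mono)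
    then have le: "(\<Sum>i. q (A i)) \<le> q (\<Union>i. A i)"
      by (intro suminf_le_const) auto
    \<comment> \<open>A competitor \<open>B\<close> is cut into the pieces
      \<open>B \<inter> A i\<close>, each of which competes in \<open>q (A i)\<close>; countable
      additivity of \<open>\<mu>\<close> recovers \<open>\<mu> B\<close> as the limit of the partial
      sums.\<close>
    have "q (\<Union>i. A i) \<le> (\<Sum>i. q (A i))"
      unfolding q_def[of "\<Union>i. A i"]
    proof (rule SUP_least)
      fix B assume B: "B \<in> {B \<in> sets borel. B \<subseteq> (\<Union>i. A i)}"
      have "(\<lambda>n. \<mu> (B \<inter> A n)) sums \<mu> (\<Union>n. B \<inter> A n)"
        by (rule signed_measures_sums[OF \<mu>]) (use A B in \<open>auto simp: disjoint_family_on_def\<close>)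
      moreover have "(\<Union>n. B \<inter> A n) = B" using B by auto
      ultimately have lim: "(\<lambda>n. ennreal (\<Sum>i<n. \<mu> (B \<inter> A i))) \<longlonglongrightarrow> ennreal (\<mu> B)"
        by (simp add: sums_def tendsto_ennrealI)
      have "ennreal (\<Sum>i<n. \<mu> (B \<inter> A i)) \<le> (\<Sum>i. q (A i))" for n
      proof -
        \<comment> \<open>The terms may be negative, and then \<open>ennreal\<close> does not
          commute with the sum; raising each term to its maximum with 0 first makes it
          commute.\<close>
        have "ennreal (\<Sum>i<n. \<mu> (B \<inter> A i)) \<le> ennreal (\<Sum>i<n. max 0 (\<mu> (B \<inter> A i)))"
          by (intro ennreal_leI sum_mono) simp
        also have "\<dots> = (\<Sum>i<n. ennreal (\<mu> (B \<inter> A i)))"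
          by (subst sum_ennreal[symmetric]) (simp_all add: ennreal_max_0 del: sum_ennreal)
        also have "\<dots> \<le> (\<Sum>i<n. q (A i))"
          by (intro sum_mono q_upper) (use A B in auto)
        also have "\<dots> \<le> (\<Sum>i. q (A i))"
          by (rule sum_le_suminf) auto
        finally show ?thesis .
      qed
      then show "ennreal (\<mu> B) \<le> (\<Sum>i. q (A i))"
        by (intro LIMSEQ_le_const2[OF lim]) auto
    qed
    with le show "(\<Sum>i. q (A i)) = q (\<Union>i. A i)" by (rule antisym)
  qed
  moreover have "sigma_algebra UNIV (sets borel :: 'a set set)"
    using sets.sigma_algebra_axioms[of "borel :: 'a measure"] by simp
  ultimately have "emeasure (measure_of UNIV (sets borel) q) A = q A"
    using q_empty \<open>A \<in> sets borel\<close> by (intro emeasure_measure_of_sigma) (auto simp: positive_def)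
  then show ?thesis by (simp only: positive_part_def q_def[abs_def])
qed

lemma emeasure_positive_part_le:
  fixes \<mu> :: "'a::topological_space set \<Rightarrow> real"
  assumes "\<mu> \<in> signed_measures" "total_variation \<mu> \<le> ennreal C" "0 \<le> C"
  shows "emeasure (positive_part \<mu>) UNIV \<le> ennreal C"
  unfolding emeasure_positive_part[OF assms(1) space_in_borel]
proof (rule SUP_least)
  fix B :: "'a set" assume "B \<in> {B \<in> sets borel. B \<subseteq> UNIV}"
  then have "\<bar>\<mu> B\<bar> \<le> C" using abs_le_total_variation assms(2,3) by blast
  then show "ennreal (\<mu> B) \<le> ennreal C" by (intro ennreal_leI) simp
qed

lemma total_variation_uminus: "total_variation (\<lambda>A. - \<mu> A) = total_variation \<mu>"
  by (simp add: total_variation_def)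

lemma finite_measure_positive_part:
  assumes "\<mu> \<in> signed_measures"
  shows "finite_measure (positive_part \<mu>)"
proof -
  obtain C where "0 \<le> C" "total_variation \<mu> \<le> ennreal C"
    using assms by (rule signed_measures_total_variation)
  then show ?thesis
    using emeasure_positive_part_le[OF assms]
    by (intro finite_measureI) (auto simp: top_unique)
qed

lemma finite_measure_negative_part:
  "\<mu> \<in> signed_measures \<Longrightarrow> finite_measure (negative_part \<mu>)"
  unfolding negative_part_def by (intro finite_measure_positive_part signed_measures_uminus)

lemma measure_positive_part_le:
  assumes "\<mu> \<in> signed_measures" "total_variation \<mu> \<le> ennreal C" "0 \<le> C"
  shows "measure (positive_part \<mu>) UNIV \<le> C"
  using emeasure_positive_part_le[OF assms] assms(3) by (simp add: measure_def enn2real_leI)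

lemma measure_negative_part_le:
  assumes "\<mu> \<in> signed_measures" "total_variation \<mu> \<le> ennreal C" "0 \<le> C"
  shows "measure (negative_part \<mu>) UNIV \<le> C"
  unfolding negative_part_def using assms
  by (intro measure_positive_part_le signed_measures_uminus) (auto simp: total_variation_uminus)

text \<open>No Hahn decomposition is needed: \<open>B \<mapsto> A - B\<close> permutes the Borel subsets of \<open>A\<close>,
  and \<open>\<mu> B = \<mu> A + (- \<mu> (A - B))\<close>, so the two suprema differ by \<open>\<mu> A\<close>.\<close>

lemma jordan_decomposition:
  fixes \<mu> :: "'a::topological_space set \<Rightarrow> real"
  assumes \<mu>: "\<mu> \<in> signed_measures" and A: "A \<in> sets borel"
  shows "measure (positive_part \<mu>) A - measure (negative_part \<mu>) A = \<mu> A"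
proof -
  have *: "measure (positive_part \<nu>) A \<le> measure (negative_part \<nu>) A + \<nu> A"
    if \<nu>: "\<nu> \<in> signed_measures" for \<nu> :: "'a set \<Rightarrow> real"
  proof -
    interpret n: finite_measure "negative_part \<nu>" by (rule finite_measure_negative_part[OF \<nu>])
    have le: "\<nu> B \<le> measure (negative_part \<nu>) A + \<nu> A" if B: "B \<in> sets borel" "B \<subseteq> A" for B
    proof -
      have "ennreal (- \<nu> (A - B)) \<le> emeasure (negative_part \<nu>) A"
        unfolding negative_part_def emeasure_positive_part[OF signed_measures_uminus[OF \<nu>] A]
        by (rule SUP_upper) (use A B in auto)
      then have "- \<nu> (A - B) \<le> measure (negative_part \<nu>) A"
        by (simp add: n.emeasure_eq_measure)
      moreover have "\<nu> A = \<nu> B + \<nu> (A - B)"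
        using signed_measures_Un[OF \<nu>, of B "A - B"] A B by (simp add: Un_absorb1)
      ultimately show ?thesis by simp
    qed
    have "emeasure (positive_part \<nu>) A \<le> ennreal (measure (negative_part \<nu>) A + \<nu> A)"
      unfolding emeasure_positive_part[OF \<nu> A]
      by (rule SUP_least) (auto intro!: ennreal_leI le)
    moreover have "0 \<le> measure (negative_part \<nu>) A + \<nu> A"
      using le[of "{}"] signed_measures_empty[OF \<nu>] by simp
    ultimately show ?thesis by (simp add: measure_def enn2real_leI)
  qed
  \<comment> \<open>Passing to \<open>- \<mu>\<close> exchanges the two parts, so the second
    instance of the inequality is the reverse of the first.\<close>
  show ?thesis
    using *[OF \<mu>] *[OF signed_measures_uminus[OF \<mu>]] by (simp add: negative_part_def)
qed

section \<open>Bounded Borel functions\<close>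

lemma bounded_borelI:
  assumes "g \<in> borel_measurable borel" "\<And>x. \<bar>g x\<bar> \<le> C"
  shows "g \<in> bounded_borel"
  using assms by (auto simp: bounded_borel_def bounded_iff)

lemma bounded_borelE:
  assumes "g \<in> bounded_borel"
  obtains C where "0 \<le> C" "\<And>x. \<bar>g x\<bar> \<le> C" "g \<in> borel_measurable borel"
proof -
  obtain C where "\<And>x. \<bar>g x\<bar> \<le> C" "g \<in> borel_measurable borel"
    using assms by (auto simp: bounded_borel_def bounded_iff)
  \<comment> \<open>The type is inhabited, so any bound for the absolute values is
    nonnegative.\<close>
  moreover have "0 \<le> C" using order_trans[OF abs_ge_zero \<open>\<bar>g undefined\<bar> \<le> C\<close>] .
  ultimately show thesis using that by blast
qed

lemma bounded_borel_lincomb: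
  assumes "g \<in> bounded_borel" "h \<in> bounded_borel"
  shows "(\<lambda>x. a * g x + b * h x) \<in> bounded_borel"
proof -
  obtain C where C: "\<And>x. \<bar>g x\<bar> \<le> C" "g \<in> borel_measurable borel"
    using assms(1) by (rule bounded_borelE) blast
  obtain D where D: "\<And>x. \<bar>h x\<bar> \<le> D" "h \<in> borel_measurable borel"
    using assms(2) by (rule bounded_borelE) blast
  show ?thesis
  proof (rule bounded_borelI[where C = "\<bar>a\<bar> * C + \<bar>b\<bar> * D"])
    fix x
    have "\<bar>a * g x + b * h x\<bar> \<le> \<bar>a\<bar> * \<bar>g x\<bar> + \<bar>b\<bar> * \<bar>h x\<bar>"
      by (simp add: abs_mult[symmetric] abs_triangle_ineq)
    also have "\<dots> \<le> \<bar>a\<bar> * C + \<bar>b\<bar> * D"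
      by (intro add_mono mult_left_mono C D) auto
    finally show "\<bar>a * g x + b * h x\<bar> \<le> \<bar>a\<bar> * C + \<bar>b\<bar> * D" .
  qed (use C D in measurable)
qed

lemma bounded_borel_indicator: "A \<in> sets borel \<Longrightarrow> indicator A \<in> bounded_borel"
  by (rule bounded_borelI[where C = 1]) (auto simp: indicator_def)

lemma bounded_borel_limit:
  assumes "\<And>n::nat. g n \<in> borel_measurable borel" "\<And>n x. \<bar>g n x\<bar> \<le> C" "\<And>x. (\<lambda>n. g n x) \<longlonglongrightarrow> h x"
  shows "h \<in> bounded_borel"
proof (rule bounded_borelI)
  show "h \<in> borel_measurable borel"
    by (rule borel_measurable_LIMSEQ_metric[of g]) (use assms in auto)
  show "\<bar>h x\<bar> \<le> C" for x
    by (rule LIMSEQ_le_const2[OF tendsto_rabs[OF assms(3)]]) (use assms in auto)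
qed

text \<open>The embedding of the first space at height \<open>y\<close> is continuous, hence Borel.
  This handles \<open>f\<close> that is Borel only for the product topology, without recourse to the
  product sigma-algebra.\<close>

lemma bounded_borel_section:
  fixes f :: "'a::topological_space \<times> 'b::topological_space \<Rightarrow> real"
  assumes "f \<in> bounded_borel"
  shows "(\<lambda>x. f (x, y)) \<in> bounded_borel"
proof -
  obtain C where C: "\<And>z. \<bar>f z\<bar> \<le> C" "f \<in> borel_measurable borel"
    using assms by (rule bounded_borelE) blast
  have "(\<lambda>x. (x, y)) \<in> borel_measurable borel"
    by (intro borel_measurable_continuous_onI continuous_intros)
  then show ?thesis
    using C by (intro bounded_borelI[where C = C]) (auto intro: measurable_compose)
qed

text \<open>Simple functions are finite combinations of indicators, and a bounded Borel function is
  a pointwise limit of uniformly bounded simple ones. The uniform bound in the \<open>limit\<close>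
  case is what dominated convergence asks for on finite measures.\<close>

lemma bounded_borel_induct [consumes 1, case_names indicator lincomb limit]:
  fixes g :: "'a::topological_space \<Rightarrow> real"
  assumes "g \<in> bounded_borel"
    and indicator: "\<And>A. A \<in> sets borel \<Longrightarrow> P (indicator A)"
    and lincomb: "\<And>g h a b. g \<in> bounded_borel \<Longrightarrow> h \<in> bounded_borel \<Longrightarrow> P g \<Longrightarrow> P h \<Longrightarrow>
      P (\<lambda>x. a * g x + b * h x)"
    and limit: "\<And>(u :: nat \<Rightarrow> 'a \<Rightarrow> real) h C. 0 \<le> C \<Longrightarrow> (\<And>n. u n \<in> borel_measurable borel) \<Longrightarrow>
      (\<And>n x. \<bar>u n x\<bar> \<le> C) \<Longrightarrow> (\<And>x. (\<lambda>n. u n x) \<longlonglongrightarrow> h x) \<Longrightarrow> (\<And>n. P (u n)) \<Longrightarrow> P h"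
  shows "P g"
proof -
  obtain C where C: "0 \<le> C" "\<And>x. \<bar>g x\<bar> \<le> C" "g \<in> borel_measurable borel"
    using assms(1) by (rule bounded_borelE) blast
  \<comment> \<open>The approximation is taken relative to the base point 0, so its distance
    estimate becomes a bound by twice \<open>\<bar>g x\<bar>\<close>; this is the source of
    \<open>2 * C\<close> below.\<close>
  obtain u where u: "\<And>i. simple_function borel (u i)" "\<And>x. (\<lambda>i. u i x) \<longlonglongrightarrow> g x"
    "\<And>i x. \<bar>u i x\<bar> \<le> 2 * \<bar>g x\<bar>"
    using borel_measurable_implies_sequence_metric[OF C(3), of 0] by auto
  \<comment> \<open>Membership and \<open>P\<close> go through the induction together, since the
    \<open>lincomb\<close> case asks for both.\<close>
  have bb: "(\<lambda>x. \<Sum>y\<in>S. y * indicator (A y) x) \<in> bounded_borel \<and> P (\<lambda>x. \<Sum>y\<in>S. y * indicator (A y) x)"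
    if "finite S" "\<And>y. y \<in> S \<Longrightarrow> A y \<in> sets borel" for S A
    using that
  proof (induction S)
    case empty
    have "indicator ({} :: 'a set) = (\<lambda>x. 0 :: real)" by (simp add: fun_eq_iff)
    then show ?case
      using indicator[of "{}"] bounded_borel_indicator[of "{} :: 'a set"] by simp
  next
    case (insert y S)
    let ?h = "\<lambda>x. \<Sum>z\<in>S. z * indicator (A z) x"
    have eq: "(\<lambda>x. \<Sum>z\<in>insert y S. z * indicator (A z) x) = (\<lambda>x. y * indicator (A y) x + 1 * ?h x)"
      by (intro ext) (simp only: sum.insert[OF insert(1,2)] mult_1)
    have h: "?h \<in> bounded_borel" "P ?h" and A: "A y \<in> sets borel"
      using insert by auto
    show ?case
      unfolding eq
      by (rule conjI[OF bounded_borel_lincomb[OF bounded_borel_indicator[OF A] h(1)]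
            lincomb[OF bounded_borel_indicator[OF A] h(1) indicator[OF A] h(2)]])
  qed
  have "P (u i)" for i
  proof -
    have "u i = (\<lambda>x. \<Sum>y\<in>range (u i). y * indicator (u i -` {y}) x)"
    proof
      fix x
      show "u i x = (\<Sum>y\<in>range (u i). y * indicator (u i -` {y}) x)"
        by (rule trans[OF simple_function_indicator_representation_banach[OF u(1)[of i]]])
          (simp_all add: mult.commute)
    qed
    moreover have "finite (range (u i))" "u i -` {y} \<in> sets borel" for y
      using simple_functionD(1)[OF u(1)[of i]] simple_functionD(2)[OF u(1)[of i], of "{y}"] by auto
    ultimately show ?thesis
      using bb[of "range (u i)" "\<lambda>y. u i -` {y}"] by simp
  qed
  moreover have "\<bar>u i x\<bar> \<le> 2 * C" for i x
    using u(3)[of i x] C(2)[of x] by linarith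
  ultimately show ?thesis
    using u C(1) by (intro limit[of "2 * C" u g]) (auto intro: borel_measurable_simple_function)
qed

section \<open>Integration against signed measures\<close>

lemma integrable_bounded_borel:
  assumes "finite_measure M" "sets M = sets borel" "g \<in> bounded_borel"
  shows "integrable M g"
proof -
  interpret finite_measure M by fact
  obtain C where C: "\<And>x. \<bar>g x\<bar> \<le> C" "g \<in> borel_measurable borel"
    using assms(3) by (rule bounded_borelE) blast
  have "g \<in> borel_measurable M" using C(2) measurable_cong_sets[OF assms(2) refl] by blast
  then show ?thesis
    by (intro integrable_const_bound[where B = C]) (use C in auto)
qed

lemma integrable_positive_part:
  "\<mu> \<in> signed_measures \<Longrightarrow> g \<in> bounded_borel \<Longrightarrow> integrable (positive_part \<mu>) g"
  by (intro integrable_bounded_borel finite_measure_positive_part) auto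

lemma integrable_negative_part:
  "\<mu> \<in> signed_measures \<Longrightarrow> g \<in> bounded_borel \<Longrightarrow> integrable (negative_part \<mu>) g"
  by (intro integrable_bounded_borel finite_measure_negative_part) auto

lemma signed_integral_lincomb:
  assumes "\<mu> \<in> signed_measures" "g \<in> bounded_borel" "h \<in> bounded_borel"
  shows "signed_integral \<mu> (\<lambda>x. a * g x + b * h x) = a * signed_integral \<mu> g + b * signed_integral \<mu> h"
  using integrable_positive_part[OF assms(1)] integrable_negative_part[OF assms(1)] assms(2,3)
  by (simp add: signed_integral_def algebra_simps)

lemma signed_integral_indicator:
  assumes "\<mu> \<in> signed_measures" "A \<in> sets borel"
  shows "signed_integral \<mu> (indicator A) = \<mu> A"
  using jordan_decomposition[OF assms] by (simp add: signed_integral_def)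

lemma abs_integral_le:
  assumes "finite_measure M" "space M = UNIV" "sets M = sets borel" "g \<in> borel_measurable borel"
    and "\<And>x. \<bar>g x\<bar> \<le> B" "measure M UNIV \<le> C" "0 \<le> B"
  shows "\<bar>integral\<^sup>L M g\<bar> \<le> B * C"
proof -
  interpret finite_measure M by fact
  have int: "integrable M g"
    by (rule integrable_bounded_borel[OF assms(1,3) bounded_borelI[OF assms(4,5)]])
  have "\<bar>integral\<^sup>L M g\<bar> \<le> (\<integral>x. \<bar>g x\<bar> \<partial>M)" by (rule integral_abs_bound)
  also have "\<dots> \<le> (\<integral>x. B \<partial>M)"
    by (rule integral_mono) (use int assms(5) in auto)
  also have "\<dots> \<le> B * C"
    using assms(2,6,7) by (simp add: mult.commute mult_left_mono)
  finally show ?thesis .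
qed

text \<open>The factor 2 arises because each Jordan part is estimated separately by the full total
  variation; the later arguments ask only for some uniform bound.\<close>

lemma abs_signed_integral_le:
  assumes "\<mu> \<in> signed_measures" "total_variation \<mu> \<le> ennreal C" "0 \<le> C"
    and "g \<in> borel_measurable borel" "\<And>x. \<bar>g x\<bar> \<le> B" "0 \<le> B"
  shows "\<bar>signed_integral \<mu> g\<bar> \<le> 2 * B * C"
proof -
  have "\<bar>integral\<^sup>L (positive_part \<mu>) g\<bar> \<le> B * C"
    by (rule abs_integral_le)
      (use assms in \<open>auto intro: finite_measure_positive_part measure_positive_part_le\<close>)
  moreover have "\<bar>integral\<^sup>L (negative_part \<mu>) g\<bar> \<le> B * C"
    by (rule abs_integral_le)
      (use assms in \<open>auto intro: finite_measure_negative_part measure_negative_part_le\<close>)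
  ultimately show ?thesis unfolding signed_integral_def by linarith
qed

text \<open>Both Jordan parts are finite measures, so the constant \<open>C\<close> is an integrable
  majorant for each and dominated convergence applies twice.\<close>

lemma signed_integral_tendsto:
  assumes \<mu>: "\<mu> \<in> signed_measures"
    and u: "\<And>n. u n \<in> borel_measurable borel" "\<And>n x. \<bar>u n x\<bar> \<le> C" "\<And>x. (\<lambda>n. u n x) \<longlonglongrightarrow> h x"
  shows "(\<lambda>n. signed_integral \<mu> (u n)) \<longlonglongrightarrow> signed_integral \<mu> h"
proof -
  have h: "h \<in> borel_measurable borel"
    using bounded_borel_limit[OF u] by (simp add: bounded_borel_def)
  have *: "(\<lambda>n. integral\<^sup>L M (u n)) \<longlonglongrightarrow> integral\<^sup>L M h"
    if "finite_measure M" "sets M = sets borel" for M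
  proof (rule integral_dominated_convergence[where w = "\<lambda>_. C"])
    interpret finite_measure M by fact
    show "integrable M (\<lambda>_. C)" by simp
    show "h \<in> borel_measurable M" "u n \<in> borel_measurable M" for n
      using h u(1) measurable_cong_sets[OF that(2) refl] by blast+
  qed (use u in auto)
  show ?thesis
    unfolding signed_integral_def
    by (intro tendsto_diff * finite_measure_positive_part[OF \<mu>] finite_measure_negative_part[OF \<mu>]) auto
qed

lemma signed_integral_sum:
  assumes "\<mu> \<in> signed_measures" "finite S" "\<And>i. i \<in> S \<Longrightarrow> g i \<in> bounded_borel"
  shows "(\<lambda>x. \<Sum>i\<in>S. c i * g i x) \<in> bounded_borel \<and>
    signed_integral \<mu> (\<lambda>x. \<Sum>i\<in>S. c i * g i x) = (\<Sum>i\<in>S. c i * signed_integral \<mu> (g i))"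
  using assms(2,3)
proof (induction S)
  case empty
  then show ?case
    by (auto simp: signed_integral_def intro!: bounded_borelI[where C = 0])
next
  case (insert i S)
  then show ?case
    using signed_integral_lincomb[OF assms(1), of "g i" "\<lambda>x. \<Sum>i\<in>S. c i * g i x" "c i" 1]
      bounded_borel_lincomb[of "g i" "\<lambda>x. \<Sum>i\<in>S. c i * g i x" "c i" 1]
    by simp
qed

text \<open>The Jordan parts of a combination are in general not the combinations of the Jordan
  parts, so linearity in the measure cannot be read off the definition of the integral. On
  indicators the integral is evaluation of the measure, and the induction principle extends the
  identity.\<close>

lemma signed_integral_lincomb_measure:
  assumes \<mu>: "\<mu> \<in> signed_measures" and \<nu>: "\<nu> \<in> signed_measures" and g: "g \<in> bounded_borel"
  shows "signed_integral (\<lambda>A. a * \<mu> A + b * \<nu> A) g = a * signed_integral \<mu> g + b * signed_integral \<nu> g"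
  using g
proof (induction g rule: bounded_borel_induct)
  case (indicator A)
  then show ?case by (simp add: signed_integral_indicator signed_measures_lincomb \<mu> \<nu>)
next
  case (lincomb g h c d)
  then show ?case
    by (simp add: signed_integral_lincomb signed_measures_lincomb \<mu> \<nu> algebra_simps)
next
  case (limit u h C)
  note lim = signed_integral_tendsto[OF _ limit(2,3,4)]
  have "(\<lambda>n. signed_integral (\<lambda>A. a * \<mu> A + b * \<nu> A) (u n)) \<longlonglongrightarrow>
      a * signed_integral \<mu> h + b * signed_integral \<nu> h"
    unfolding limit(5) by (intro tendsto_intros lim \<mu> \<nu>)
  then show ?case
    using lim[OF signed_measures_lincomb[OF \<mu> \<nu>]] LIMSEQ_unique by blast
qed

text \<open>Makes each section of \<open>f\<close> an element of the image of the transform. The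
  value 0 off the Borel sets is dictated by membership in \<open>signed_measures\<close>.\<close>

definition dirac :: "'a::topological_space \<Rightarrow> 'a set \<Rightarrow> real" where
  "dirac x A = (if A \<in> sets borel then indicator A x else 0)"

lemma dirac_signed_measure: "dirac x \<in> signed_measures"
proof (rule signed_measuresI[where C = 1])
  fix \<P> :: "'a set set" assume P: "finite \<P>" "\<P> \<subseteq> sets borel" "disjoint \<P>"
  have "(\<Sum>A\<in>\<P>. \<bar>dirac x A\<bar>) = (\<Sum>A\<in>\<P>. indicator A x)"
    using P(2) by (intro sum.cong) (auto simp: dirac_def)
  also have "\<dots> = indicator (\<Union>\<P>) x"
    using P(1,3) by (subst indicator_UN_disjoint[of \<P> "\<lambda>A. A", simplified])
      (auto simp: disjoint_family_on_def disjoint_def)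
  also have "\<dots> \<le> 1" by (simp add: indicator_def)
  finally show "(\<Sum>A\<in>\<P>. \<bar>dirac x A\<bar>) \<le> 1" .
next
  fix A :: "nat \<Rightarrow> 'a set" assume A: "range A \<subseteq> sets borel" "disjoint_family A"
  then have "(\<lambda>n. indicator (A n) x) sums (indicator (\<Union>n. A n) x :: real)"
    by (intro indicator_sums) (auto simp: disjoint_family_on_def)
  then show "(\<lambda>n. dirac x (A n)) sums dirac x (\<Union>n. A n)"
    using A(1) by (simp add: dirac_def subset_eq)
qed (auto simp: dirac_def)

text \<open>The Jordan parts of \<open>dirac x\<close> are never computed: the identity is clear on
  indicators, and both sides respect linear combinations and bounded limits.\<close>

lemma signed_integral_dirac: "g \<in> bounded_borel \<Longrightarrow> signed_integral (dirac x) g = g x"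
proof (induction g rule: bounded_borel_induct)
  case (indicator A)
  then show ?case by (simp add: signed_integral_indicator dirac_signed_measure) (simp add: dirac_def)
next
  case (lincomb g h c d)
  then show ?case by (simp add: signed_integral_lincomb dirac_signed_measure)
next
  case (limit u h C)
  have "(\<lambda>n. u n x) \<longlonglongrightarrow> signed_integral (dirac x) h"
    using signed_integral_tendsto[OF dirac_signed_measure limit(2,3,4), of x] by (simp only: limit(5))
  then show ?case using limit(4) by (rule LIMSEQ_unique)
qed

section \<open>Kernels and their dual operators\<close>

lemma bounded_signed_kernel_measure: "bounded_signed_kernel p \<Longrightarrow> p x \<in> signed_measures"
  and bounded_signed_kernel_measurable:
    "bounded_signed_kernel p \<Longrightarrow> A \<in> sets borel \<Longrightarrow> (\<lambda>x. p x A) \<in> borel_measurable borel"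
  by (simp_all add: bounded_signed_kernel_def signed_kernel_def)

lemma bounded_signed_kernel_bound:
  assumes "bounded_signed_kernel p"
  obtains K where "0 \<le> K" "\<And>x. total_variation (p x) \<le> ennreal K"
proof
  have "total_variation (p x) \<le> (SUP x. total_variation (p x))" for x
    by (rule SUP_upper) simp
  then show "total_variation (p x) \<le> ennreal (enn2real (SUP x. total_variation (p x)))" for x
    using assms by (simp add: bounded_signed_kernel_def)
qed simp

lemma bounded_borel_kernel:
  assumes p: "bounded_signed_kernel p" and A: "A \<in> sets borel"
  shows "(\<lambda>x. p x A) \<in> bounded_borel"
proof -
  obtain K where "0 \<le> K" "\<And>x. total_variation (p x) \<le> ennreal K"
    using p by (rule bounded_signed_kernel_bound) blast
  then show ?thesis
    by (intro bounded_borelI bounded_signed_kernel_measurable[OF p A] abs_le_total_variation[OF A])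
qed

text \<open>For indicators, measurability in \<open>x\<close> is part of the definition of a kernel;
  it survives linear combinations and pointwise limits. Boundedness comes from the uniform bound
  \<open>K\<close> on the total variations.\<close>

lemma integral_operator_bounded_borel:
  assumes p: "bounded_signed_kernel p" and g: "g \<in> bounded_borel"
  shows "integral_operator p g \<in> bounded_borel"
proof -
  obtain K where K: "0 \<le> K" "\<And>x. total_variation (p x) \<le> ennreal K"
    using p by (rule bounded_signed_kernel_bound) blast
  obtain C where C: "0 \<le> C" "\<And>x. \<bar>g x\<bar> \<le> C" "g \<in> borel_measurable borel"
    using g by (rule bounded_borelE) blast
  note px = bounded_signed_kernel_measure[OF p]
  have "(\<lambda>x. signed_integral (p x) g) \<in> borel_measurable borel"
    using g
  proof (induction g rule: bounded_borel_induct)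
    case (indicator A)
    then show ?case
      by (simp add: signed_integral_indicator px bounded_signed_kernel_measurable[OF p])
  next
    case (lincomb g h a b)
    then show ?case by (simp add: signed_integral_lincomb px)
  next
    case (limit u h C)
    show ?case
      by (rule borel_measurable_LIMSEQ_metric[OF limit(5)])
        (rule signed_integral_tendsto[OF px limit(2,3,4)])
  qed
  then show ?thesis
    unfolding integral_operator_def
    by (rule bounded_borelI[OF _ abs_signed_integral_le[OF px K(2,1) C(3,2,1)]])
qed

text \<open>Countable additivity is that of each \<open>p x\<close>, carried through the integral by
  bounded convergence; finite total variation comes from a choice of signs.\<close>

lemma dual_operator_signed_measures:
  fixes p :: "'a::topological_space \<Rightarrow> 'a set \<Rightarrow> real"
  assumes p: "bounded_signed_kernel p" and \<mu>: "\<mu> \<in> signed_measures"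
  shows "dual_operator p \<mu> \<in> signed_measures"
proof -
  obtain K where K: "0 \<le> K" "\<And>x. total_variation (p x) \<le> ennreal K"
    using p by (rule bounded_signed_kernel_bound) blast
  obtain C where C: "0 \<le> C" "total_variation \<mu> \<le> ennreal C"
    using \<mu> by (rule signed_measures_total_variation)
  note px = bounded_signed_kernel_measure[OF p]
  note bb = bounded_borel_kernel[OF p]
  show ?thesis
  proof (rule signed_measuresI[where C = "2 * K * C"])
    show "dual_operator p \<mu> {} = 0"
      by (simp add: dual_operator_def signed_measures_empty[OF px] signed_integral_def)
  next
    fix A :: "nat \<Rightarrow> 'a set" assume A: "range A \<subseteq> sets borel" "disjoint_family A"
    have "(\<lambda>n. signed_integral \<mu> (\<lambda>x. \<Sum>i<n. p x (A i))) \<longlonglongrightarrow> signed_integral \<mu> (\<lambda>x. p x (\<Union>i. A i))"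
    proof (rule signed_integral_tendsto[OF \<mu>])
      show "(\<lambda>x. \<Sum>i<n. p x (A i)) \<in> borel_measurable borel" for n
        using A by (intro borel_measurable_sum bounded_signed_kernel_measurable[OF p]) auto
      \<comment> \<open>The sum equals \<open>p x\<close> of a finite union, hence is at most
        \<open>K\<close> for all \<open>n\<close> and \<open>x\<close>.\<close>
      show "\<bar>\<Sum>i<n. p x (A i)\<bar> \<le> K" for n x
        unfolding signed_measures_sum_disjoint[OF px A]
        using A by (intro abs_le_total_variation[OF _ K(2,1)]) auto
      show "(\<lambda>n. \<Sum>i<n. p x (A i)) \<longlonglongrightarrow> p x (\<Union>i. A i)" for x
        using signed_measures_sums[OF px A] by (simp add: sums_def)
    qed
    moreover have "signed_integral \<mu> (\<lambda>x. \<Sum>i<n. p x (A i)) = (\<Sum>i<n. dual_operator p \<mu> (A i))" for n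
      using signed_integral_sum[OF \<mu>, of "{..<n}" "\<lambda>i x. p x (A i)" "\<lambda>_. 1"] bb A
      by (simp add: dual_operator_def subset_eq)
    moreover have "dual_operator p \<mu> (\<Union>i. A i) = signed_integral \<mu> (\<lambda>x. p x (\<Union>i. A i))"
      using A by (simp add: dual_operator_def subset_eq)
    ultimately show "(\<lambda>n. dual_operator p \<mu> (A n)) sums dual_operator p \<mu> (\<Union>n. A n)"
      by (simp add: sums_def)
  next
    fix \<P> :: "'a set set" assume P: "finite \<P>" "\<P> \<subseteq> sets borel" "disjoint \<P>"
    \<comment> \<open>With these signs the sum of absolute values becomes a single integral, whose
      integrand is bounded pointwise by the variation of \<open>p x\<close> and so by
      \<open>K\<close>.\<close>
    define c where "c A = sgn (dual_operator p \<mu> A)" for A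
    have "(\<Sum>A\<in>\<P>. \<bar>dual_operator p \<mu> A\<bar>) = (\<Sum>A\<in>\<P>. c A * signed_integral \<mu> (\<lambda>x. p x A))"
      using P(2) by (intro sum.cong) (auto simp: c_def abs_sgn dual_operator_def mult.commute)
    also have "\<dots> = signed_integral \<mu> (\<lambda>x. \<Sum>A\<in>\<P>. c A * p x A)"
      by (rule signed_integral_sum[OF \<mu> P(1), THEN conjunct2, symmetric]) (use bb P(2) in blast)
    also have "\<dots> \<le> \<bar>signed_integral \<mu> (\<lambda>x. \<Sum>A\<in>\<P>. c A * p x A)\<bar>" by simp
    also have "\<dots> \<le> 2 * K * C"
    proof (rule abs_signed_integral_le[OF \<mu> C(2,1)])
      show "(\<lambda>x. \<Sum>A\<in>\<P>. c A * p x A) \<in> borel_measurable borel"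
        using P(2) by (intro borel_measurable_sum borel_measurable_times
            bounded_signed_kernel_measurable[OF p]) auto
      fix x
      have "\<bar>\<Sum>A\<in>\<P>. c A * p x A\<bar> \<le> (\<Sum>A\<in>\<P>. \<bar>c A * p x A\<bar>)" by (rule sum_abs)
      also have "\<dots> \<le> (\<Sum>A\<in>\<P>. \<bar>p x A\<bar>)"
        by (rule sum_mono) (auto simp: c_def abs_mult abs_sgn_eq)
      also have "\<dots> \<le> K" by (rule sum_abs_le_total_variation[OF P K(2,1)])
      finally show "\<bar>\<Sum>A\<in>\<P>. c A * p x A\<bar> \<le> K" .
    qed fact
    finally show "(\<Sum>A\<in>\<P>. \<bar>dual_operator p \<mu> A\<bar>) \<le> 2 * K * C" .
  qed (simp add: dual_operator_def)
qed

lemma signed_integral_dual_operator: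
  assumes p: "bounded_signed_kernel p" and \<mu>: "\<mu> \<in> signed_measures" and g: "g \<in> bounded_borel"
  shows "signed_integral (dual_operator p \<mu>) g = signed_integral \<mu> (integral_operator p g)"
  using g
proof (induction g rule: bounded_borel_induct)
  case (indicator A)
  have "signed_integral (dual_operator p \<mu>) (indicator A) = dual_operator p \<mu> A"
    by (rule signed_integral_indicator[OF dual_operator_signed_measures[OF p \<mu>] indicator])
  also have "\<dots> = signed_integral \<mu> (\<lambda>x. p x A)"
    using indicator by (simp add: dual_operator_def)
  also have "(\<lambda>x. p x A) = integral_operator p (indicator A)"
    unfolding integral_operator_def
    by (rule ext) (rule signed_integral_indicator[OF bounded_signed_kernel_measure[OF p] indicator, symmetric])
  finally show ?case .
next
  case (lincomb g h a b)
  have "integral_operator p (\<lambda>x. a * g x + b * h x) =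
      (\<lambda>x. a * integral_operator p g x + b * integral_operator p h x)"
    unfolding integral_operator_def
    by (rule ext) (rule signed_integral_lincomb[OF bounded_signed_kernel_measure[OF p] lincomb(1,2)])
  then show ?case
    using signed_integral_lincomb[OF dual_operator_signed_measures[OF p \<mu>] lincomb(1,2), of a b]
      signed_integral_lincomb[OF \<mu> lincomb(1,2)[THEN integral_operator_bounded_borel[OF p]], of a b]
      lincomb(3,4)
    by metis
next
  case (limit u h C)
  obtain K where K: "0 \<le> K" "\<And>x. total_variation (p x) \<le> ennreal K"
    using p by (rule bounded_signed_kernel_bound) blast
  note px = bounded_signed_kernel_measure[OF p]
  \<comment> \<open>Bounded convergence is used twice: against each \<open>p x\<close> for pointwise
    convergence of the integrands, then against \<open>\<mu>\<close>, where \<open>2 * C * K\<close>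
    bounds them uniformly.\<close>
  have "(\<lambda>n. signed_integral \<mu> (integral_operator p (u n))) \<longlonglongrightarrow> signed_integral \<mu> (integral_operator p h)"
  proof (rule signed_integral_tendsto[OF \<mu>])
    show "integral_operator p (u n) \<in> borel_measurable borel" for n
      using integral_operator_bounded_borel[OF p bounded_borelI[OF limit(2,3)]]
      by (simp add: bounded_borel_def)
    show "\<bar>integral_operator p (u n) x\<bar> \<le> 2 * C * K" for n x
      unfolding integral_operator_def
      by (rule abs_signed_integral_le[OF px K(2,1) limit(2,3,1)])
    show "(\<lambda>n. integral_operator p (u n) x) \<longlonglongrightarrow> integral_operator p h x" for x
      unfolding integral_operator_def by (rule signed_integral_tendsto[OF px limit(2,3,4)])
  qed
  then have "(\<lambda>n. signed_integral (dual_operator p \<mu>) (u n)) \<longlonglongrightarrow> signed_integral \<mu> (integral_operator p h)"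
    by (simp only: limit(5))
  with signed_integral_tendsto[OF dual_operator_signed_measures[OF p \<mu>] limit(2,3,4)]
  show ?case by (rule LIMSEQ_unique)
qed

section \<open>Duality of semigroups\<close>

lemma inj_on_integral_transform:
  assumes "separates_measures f"
  shows "inj_on (integral_transform f) signed_measures"
proof (rule inj_onI)
  fix P Q assume PQ: "P \<in> signed_measures" "Q \<in> signed_measures"
    and eq: "integral_transform f P = integral_transform f Q"
  from eq have "signed_integral P (\<lambda>x. f (x, y)) = signed_integral Q (\<lambda>x. f (x, y))" for y
    by (simp add: integral_transform_def fun_eq_iff)
  then show "P = Q" using assms PQ unfolding separates_measures_def by blast
qed

lemma integral_transform_dirac:
  assumes "f \<in> bounded_borel"
  shows "integral_transform f (dirac x) = (\<lambda>y. f (x, y))"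
  by (simp add: integral_transform_def signed_integral_dirac bounded_borel_section[OF assms])

lemma integral_transform_dual_operator:
  assumes "f \<in> bounded_borel" "bounded_signed_kernel p" "Q \<in> signed_measures"
  shows "integral_transform f (dual_operator p Q) =
    (\<lambda>y. signed_integral Q (integral_operator p (\<lambda>x. f (x, y))))"
  by (simp add: integral_transform_def signed_integral_dual_operator[OF assms(2,3) bounded_borel_section[OF assms(1)]])

text \<open>The second clause of \<open>f_dual\<close> moves \<open>TD\<close> under the integral,
  the first replaces it by the integral operator, and duality shifts that operator onto
  \<open>Q\<close>. Thus \<open>TD\<close> is determined on the whole image of the
  transform.\<close>

lemma f_dual_integral_transform:
  assumes "f_dual f (integral_operator p) TD" "f \<in> bounded_borel" "bounded_signed_kernel p"
    and "Q \<in> signed_measures"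
  shows "TD (integral_transform f Q) = integral_transform f (dual_operator p Q)"
proof
  fix y
  have "TD (integral_transform f Q) y = signed_integral Q (\<lambda>x. TD (\<lambda>y'. f (x, y')) y)"
    using assms(1,4) by (simp add: f_dual_def)
  also have "(\<lambda>x. TD (\<lambda>y'. f (x, y')) y) = integral_operator p (\<lambda>x. f (x, y))"
    using assms(1) by (simp add: f_dual_def)
  finally show "TD (integral_transform f Q) y = integral_transform f (dual_operator p Q) y"
    by (simp add: integral_transform_dual_operator[OF assms(2-4)])
qed

text \<open>Supplies the existence half of the theorem, so that its claim about all
  \<open>f\<close>-dual families is not vacuous.\<close>

lemma f_dual_conjugate:
  assumes f: "f \<in> bounded_borel" and sep: "separates_measures f" and p: "bounded_signed_kernel p"
  shows "f_dual f (integral_operator p)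
    (integral_transform f \<circ> dual_operator p \<circ> inv_into signed_measures (integral_transform f))"
    (is "f_dual f _ ?TD")
proof -
  have TD: "?TD (integral_transform f Q) y = signed_integral Q (integral_operator p (\<lambda>x. f (x, y)))"
    if "Q \<in> signed_measures" for Q y
    using that inj_on_integral_transform[OF sep]
    by (simp add: inv_into_f_f integral_transform_dual_operator[OF f p])
  have TD_section: "?TD (\<lambda>y'. f (x, y')) y = integral_operator p (\<lambda>x'. f (x', y)) x" for x y
    unfolding integral_transform_dirac[OF f, symmetric] TD[OF dirac_signed_measure]
    by (rule signed_integral_dirac[OF integral_operator_bounded_borel[OF p bounded_borel_section[OF f]]])
  show ?thesis
    unfolding f_dual_def TD_section using TD by simp
qed

text \<open>Exhibits a preimage of a linear combination, so that the formula for \<open>TD\<close>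
  on transforms can be applied to it.\<close>

lemma integral_transform_lincomb:
  assumes "f \<in> bounded_borel" "P \<in> signed_measures" "Q \<in> signed_measures"
  shows "(\<lambda>y. a * integral_transform f P y + b * integral_transform f Q y) =
    integral_transform f (\<lambda>A. a * P A + b * Q A)"
  by (simp add: integral_transform_def
      signed_integral_lincomb_measure[OF assms(2,3) bounded_borel_section[OF assms(1)]])

theorem proposition1p2:
  fixes f :: "'a::topological_space \<times> 'b::topological_space \<Rightarrow> real"
    and p :: "real \<Rightarrow> 'a \<Rightarrow> 'a set \<Rightarrow> real"
  assumes "f \<in> bounded_borel"
    and "separates_measures f"
    and "\<And>t. t \<ge> 0 \<Longrightarrow> bounded_signed_kernel (p t)"
    and "operator_semigroup bounded_borel (\<lambda>t. integral_operator (p t))"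
  shows "(\<exists>TD. \<forall>t\<ge>0. f_dual f (integral_operator (p t)) (TD t)) \<and>
    (\<forall>TD. (\<forall>t\<ge>0. f_dual f (integral_operator (p t)) (TD t)) \<longrightarrow>
       operator_semigroup (integral_transform f ` signed_measures) TD \<and>
       (\<forall>t\<ge>0. \<forall>g \<in> integral_transform f ` signed_measures.
          TD t g = (integral_transform f \<circ> dual_operator (p t) \<circ>
                    inv_into signed_measures (integral_transform f)) g))"
proof (intro conjI allI impI)
  show "\<exists>TD. \<forall>t\<ge>0. f_dual f (integral_operator (p t)) (TD t)"
    by (intro exI[where x = "\<lambda>t. integral_transform f \<circ> dual_operator (p t) \<circ>
        inv_into signed_measures (integral_transform f)"] allI impI f_dual_conjugate assms(1,2,3))
next
  fix TD assume "\<forall>t\<ge>0. f_dual f (integral_operator (p t)) (TD t)"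
  then have TD: "TD t (integral_transform f Q) = integral_transform f (dual_operator (p t) Q)"
    if "0 \<le> t" "Q \<in> signed_measures" for t Q
    using that f_dual_integral_transform assms(1,3) by blast
  note dual_sm = dual_operator_signed_measures[OF assms(3)]
  note transform_dual = integral_transform_dual_operator[OF assms(1,3)]
  note bb = bounded_borel_section[OF assms(1)]
  show "\<forall>g \<in> integral_transform f ` signed_measures.
      TD t g = (integral_transform f \<circ> dual_operator (p t) \<circ>
        inv_into signed_measures (integral_transform f)) g" if "0 \<le> t" for t
    using that inj_on_integral_transform[OF assms(2)] by (auto simp: TD inv_into_f_f)
  have T0: "integral_operator (p 0) g = g" if "g \<in> bounded_borel" for g
    using assms(4) that by (simp add: operator_semigroup_def)
  have Tadd: "integral_operator (p t) (integral_operator (p s) g) = integral_operator (p (t + s)) g"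
    if "0 \<le> s" "0 \<le> t" "g \<in> bounded_borel" for s t g
    using assms(4) that by (simp add: operator_semigroup_def)
  have lin: "integral_transform f (dual_operator (p t) (\<lambda>A. a * P A + b * Q A)) =
      (\<lambda>y. a * integral_transform f (dual_operator (p t) P) y +
        b * integral_transform f (dual_operator (p t) Q) y)"
    if "0 \<le> t" "P \<in> signed_measures" "Q \<in> signed_measures" for t a b P Q
    using that by (simp add: transform_dual signed_measures_lincomb signed_integral_lincomb_measure
        integral_operator_bounded_borel[OF assms(3) bb])
  \<comment> \<open>Dualising reverses the order of the two operators and produces the time
    \<open>s + t\<close>; commutativity of addition brings it to \<open>t + s\<close>.\<close>
  have add: "integral_transform f (dual_operator (p t) (dual_operator (p s) Q)) =
      integral_transform f (dual_operator (p (t + s)) Q)"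
    if "0 \<le> s" "0 \<le> t" "Q \<in> signed_measures" for s t Q
    using that by (simp add: transform_dual dual_sm signed_integral_dual_operator[OF assms(3)]
        integral_operator_bounded_borel[OF assms(3) bb] Tadd bb add.commute)
  show "operator_semigroup (integral_transform f ` signed_measures) TD"
    unfolding operator_semigroup_def
  proof (intro conjI allI impI ballI)
    show "TD t g \<in> integral_transform f ` signed_measures"
      if "0 \<le> t" "g \<in> integral_transform f ` signed_measures" for t g
      using that dual_sm by (auto simp: TD)
    show "TD t (\<lambda>z. a * g z + b * h z) = (\<lambda>z. a * TD t g z + b * TD t h z)"
      if "0 \<le> t" "g \<in> integral_transform f ` signed_measures"
        "h \<in> integral_transform f ` signed_measures" for t g h a b
      using that by (auto simp: TD integral_transform_lincomb[OF assms(1)] signed_measures_lincomb lin)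
    show "TD 0 g = g" if "g \<in> integral_transform f ` signed_measures" for g
      using that by (auto simp: TD transform_dual T0 bb) (simp add: integral_transform_def)
    show "TD t (TD s g) = TD (t + s) g"
      if "0 \<le> s" "0 \<le> t" "g \<in> integral_transform f ` signed_measures" for s t g
      using that by (auto simp: TD dual_sm add)
  qed
qed

end
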